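(* Let $1\le n<m\le N$, let $\Phi\in\mathbb R^{N\times m}$ be a basis matrix and $S\in\mathbb R^{N\times n}$ a selection matrix such that $S^\top\Phi$ has full rank $n$. Let $Z$ be a kernel matrix of $S^\top\Phi$ and let $\mathbb D=\Phi(S^\top\Phi)^+S^\top$. For $\mathbf u\in\mathbb R^N$, let $\hat{\mathbf u}=\Phi\Phi^\top\mathbf u$ be its orthogonal projection onto the range of $\Phi$, let $\hat{\mathbf z}=ZZ^\top\Phi^\top\mathbf u$, and for $\mathbf z\in\mathcal N[S^\top\Phi]$ let $\tilde{\mathbf u}(\mathbf z)=\mathbb D\mathbf u+\Phi\mathbf z$ be the S-DEIM reconstruction. Then $$\|\mathbf u-\tilde{\mathbf u}(\mathbf z)\|^2=\|\mathbf u-\hat{\mathbf u}\|^2+\|\mathbb D(\mathbf u-\hat{\mathbf u})\|^2+\|\hat{\mathbf z}-\mathbf z\|^2\qquad\text{for all }\mathbf z\in\mathcal N[S^\top\Phi].$$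
   Context: A basis matrix $\Phi\in\mathbb R^{N\times m}$ is a real matrix with orthonormal columns, $\Phi^\top\Phi=\mathbb I_m$. A selection matrix $S\in\mathbb R^{N\times n}$ is a matrix $S=[\mathbf e_{i_1}|\cdots|\mathbf e_{i_n}]$ whose columns are standard basis vectors of $\mathbb R^N$ with distinct indices $i_1,\dots,i_n$. $A^+$ is the Moore--Penrose pseudoinverse of $A$, $\mathcal N[A]$ is its null space, and $\|\cdot\|$ is the Euclidean norm. A kernel matrix $Z\in\mathbb R^{m\times(m-n)}$ is a matrix whose columns form an orthonormal basis of $\mathcal N[S^\top\Phi]$. The observations are $\mathbf y=S^\top\mathbf u$, and the S-DEIM reconstruction with kernel vector $\mathbf z\in\mathcal N[S^\top\Phi]$ is $\tilde{\mathbf u}(\mathbf z)=\Phi(S^\top\Phi)^+\mathbf y+\Phi\mathbf z=\mathbb D\mathbf u+\Phi\mathbf z$. *)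

theory Defs
  imports "HOL-Analysis.Analysis"
begin

definition null_space :: "real^'c^'r \<Rightarrow> (real^'c) set"
  where "null_space A = {x. A *v x = 0}"

definition basis_matrix :: "real^'m^'N \<Rightarrow> bool"
  where "basis_matrix \<Phi> \<longleftrightarrow> transpose \<Phi> ** \<Phi> = mat 1"

definition selection_matrix :: "real^'n^'N \<Rightarrow> bool"
  where "selection_matrix S \<longleftrightarrow> (\<exists>i :: 'n \<Rightarrow> 'N. inj i \<and> (\<forall>k. column k S = axis (i k) 1))"

(* The columns are treated as an indexed family, so repeated columns are excluded. *)
definition kernel_matrix :: "real^'c^'r \<Rightarrow> real^'k^'c \<Rightarrow> bool"
  where "kernel_matrix A Z \<longleftrightarrow>
    (\<forall>i j. column i Z \<bullet> column j Z = (if i = j then 1 else 0)) \<and>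
    span (columns Z) = null_space A"

(* The four Penrose conditions. *)
definition is_moore_penrose :: "real^'c^'r \<Rightarrow> real^'r^'c \<Rightarrow> bool"
  where "is_moore_penrose A X \<longleftrightarrow>
    A ** X ** A = A \<and> X ** A ** X = X \<and>
    transpose (A ** X) = A ** X \<and> transpose (X ** A) = X ** A"

definition pinv :: "real^'c^'r \<Rightarrow> real^'r^'c"
  where "pinv A = (THE X. is_moore_penrose A X)"

lemma is_moore_penrose_unique:
  assumes "is_moore_penrose A X" "is_moore_penrose A Y"
  shows "X = Y"
proof -
  have X: "A ** X ** A = A" "X ** A ** X = X" "transpose (A ** X) = A ** X" "transpose (X ** A) = X ** A"
    and Y: "A ** Y ** A = A" "Y ** A ** Y = Y" "transpose (A ** Y) = A ** Y" "transpose (Y ** A) = Y ** A"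
    using assms by (auto simp: is_moore_penrose_def)
  have "A ** X = transpose ((A ** Y) ** (A ** X))"
    using X(3) Y(1) by (metis matrix_mul_assoc)
  also have "\<dots> = (A ** X) ** (A ** Y)"
    by (simp only: matrix_transpose_mul[of "A ** Y" "A ** X"] X(3) Y(3))
  also have "\<dots> = A ** Y"
    using X(1) by (metis matrix_mul_assoc)
  finally have 1: "A ** X = A ** Y" .
  have "X ** A = transpose ((X ** A) ** (Y ** A))"
    using X(4) Y(1) by (metis matrix_mul_assoc)
  also have "\<dots> = (Y ** A) ** (X ** A)"
    by (simp only: matrix_transpose_mul[of "X ** A" "Y ** A"] X(4) Y(4))
  also have "\<dots> = Y ** A"
    using X(1) by (metis matrix_mul_assoc)
  finally have 2: "X ** A = Y ** A" .
  show ?thesis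
    using 1 2 X(2) Y(2) by (metis matrix_mul_assoc)
qed

lemma transpose_eq_selfI:
  fixes M :: "real^'n^'n"
  assumes "\<And>x y. (M *v x) \<bullet> y = x \<bullet> (M *v y)"
  shows "transpose M = M"
proof -
  have "transpose M *v y = M *v y" for y
    using assms by (metis dot_lmul_matrix inner_commute transpose_matrix_vector vector_eq_ldot)
  then show ?thesis
    by (simp add: matrix_eq)
qed

lemma is_moore_penrose_exists:
  fixes A :: "real^'c^'r"
  shows "\<exists>X. is_moore_penrose A X"
proof -
  define Q where "Q y x \<longleftrightarrow> (\<forall>k. A *v k = 0 \<longrightarrow> x \<bullet> k = 0) \<and> (\<forall>v. (A *v x - y) \<bullet> (A *v v) = 0)"
    for y x
  have eqI: "x = x'" if "\<And>k. A *v k = 0 \<Longrightarrow> x \<bullet> k = 0" "\<And>k. A *v k = 0 \<Longrightarrow> x' \<bullet> k = 0"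
    "A *v x = A *v x'" for x x'
  proof -
    have "A *v (x - x') = 0"
      using that(3) by (simp add: matrix_vector_mult_diff_distrib)
    then have "(x - x') \<bullet> (x - x') = 0"
      using that(1,2) by (simp add: inner_diff_left)
    then show ?thesis by simp
  qed
  have uniq: "x = x'" if "Q y x" "Q y x'" for y x x'
  proof (rule eqI)
    have "(A *v (x - x')) \<bullet> (A *v (x - x')) = 0"
      using that unfolding Q_def
      by (metis (no_types, lifting) diff_add_cancel diff_diff_eq2 diff_self inner_diff_left
          matrix_vector_mult_diff_distrib)
    then show "A *v x = A *v x'"
      by (simp add: matrix_vector_mult_diff_distrib)
  qed (use that Q_def in auto)
  have ex: "\<exists>x. Q y x" for y
  proof -
    have sR: "subspace (range ((*v) A))"
      by (simp add: linear_subspace_image)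
    obtain p q where p: "p \<in> span (range ((*v) A))" and q: "\<And>w. w \<in> span (range ((*v) A)) \<Longrightarrow> orthogonal q w"
      and y: "y = p + q"
      using orthogonal_subspace_decomp_exists[of "range ((*v) A)" y] by metis
    obtain v where v: "p = A *v v"
      using p sR by (auto simp: span_eq_iff[THEN iffD2])
    have sK: "subspace {k. A *v k = 0}"
      by (simp add: subspace_def matrix_vector_right_distrib matrix_vector_mult_scaleR)
    obtain k r where k: "k \<in> span {k. A *v k = 0}"
      and r: "\<And>w. w \<in> span {k. A *v k = 0} \<Longrightarrow> orthogonal r w" and vv: "v = k + r"
      using orthogonal_subspace_decomp_exists[of "{k. A *v k = 0}" v] by metis
    have "A *v k = 0"
      using k sK by (simp add: span_eq_iff[THEN iffD2])
    then have Ar: "A *v r = p"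
      by (simp add: v vv matrix_vector_right_distrib)
    have "Q y r"
      unfolding Q_def
    proof (intro conjI allI impI)
      show "r \<bullet> k = 0" if "A *v k = 0" for k
        using r[of k] that by (simp add: orthogonal_def span_base)
      show "(A *v r - y) \<bullet> (A *v v) = 0" for v
        using q[of "A *v v"] by (simp add: Ar y orthogonal_def span_base)
    qed
    then show ?thesis ..
  qed
  obtain h where h: "\<And>y. Q y (h y)"
    using ex by metis
  have h1: "h y \<bullet> k = 0" if "A *v k = 0" for y k
    using h[of y] that by (simp add: Q_def)
  have h2: "(A *v h y) \<bullet> (A *v v) = y \<bullet> (A *v v)" for y v
    using h[of y] by (simp add: Q_def inner_diff_left)
  have "linear h"
  proof (rule linearI)
    show "h (a + b) = h a + h b" for a b
      by (rule uniq[OF h])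
        (auto simp: Q_def matrix_vector_right_distrib inner_add_left inner_diff_left h1 h2)
    show "h (c *\<^sub>R b) = c *\<^sub>R h b" for c b
      by (rule uniq[OF h])
        (auto simp: Q_def matrix_vector_mult_scaleR inner_diff_left h1 h2)
  qed
  then have X: "matrix h *v y = h y" for y
    by (simp add: matrix_works)
  have AXA: "A *v h (A *v x) = A *v x" for x
  proof -
    have "(A *v (h (A *v x) - x)) \<bullet> (A *v (h (A *v x) - x)) = 0"
      using h2[of "A *v x" "h (A *v x) - x"]
      by (simp add: matrix_vector_mult_diff_distrib inner_diff_left)
    then show ?thesis
      by (simp add: matrix_vector_mult_diff_distrib)
  qed
  have sym: "h (A *v x) \<bullet> y = h (A *v x) \<bullet> h (A *v y)" for x y
    using h1[of "y - h (A *v y)" "A *v x"]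
    by (simp add: AXA matrix_vector_mult_diff_distrib inner_diff_right)
  have "is_moore_penrose A (matrix h)"
    unfolding is_moore_penrose_def
  proof (intro conjI)
    show "A ** matrix h ** A = A"
      by (simp add: matrix_eq X AXA flip: matrix_vector_mul_assoc)
    have "h (A *v h y) = h y" for y
      by (rule eqI) (auto simp: h1 AXA)
    then show "matrix h ** A ** matrix h = matrix h"
      by (simp add: matrix_eq X flip: matrix_vector_mul_assoc)
    have "(A *v h x) \<bullet> y = x \<bullet> (A *v h y)" for x y
      using h2[of x "h y"] h2[of y "h x"] by (simp add: inner_commute)
    then show "transpose (A ** matrix h) = A ** matrix h"
      by (intro transpose_eq_selfI) (simp add: X flip: matrix_vector_mul_assoc)
    have "h (A *v x) \<bullet> y = x \<bullet> h (A *v y)" for x y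
      using sym[of x y] sym[of y x] by (simp add: inner_commute)
    then show "transpose (matrix h ** A) = matrix h ** A"
      by (intro transpose_eq_selfI) (simp add: X flip: matrix_vector_mul_assoc)
  qed
  then show ?thesis ..
qed

lemma is_moore_penrose_pinv: "is_moore_penrose A (pinv A)"
  unfolding pinv_def
  using is_moore_penrose_exists is_moore_penrose_unique by (metis theI)

definition deim_operator :: "real^'m^'N \<Rightarrow> real^'n^'N \<Rightarrow> real^'N^'N"
  where "deim_operator \<Phi> S = \<Phi> ** pinv (transpose S ** \<Phi>) ** transpose S"

definition sdeim_reconstruction ::
    "real^'m^'N \<Rightarrow> real^'n^'N \<Rightarrow> real^'N \<Rightarrow> real^'m \<Rightarrow> real^'N"
  where "sdeim_reconstruction \<Phi> S u z = deim_operator \<Phi> S *v u + \<Phi> *v z"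

end

theory Submission
  imports Defs
begin

text \<open>
  Write \<open>A = S\<^sup>T \<Phi>\<close>, \<open>c = \<Phi>\<^sup>T u\<close> and \<open>w = u - \<Phi> c\<close>, and let \<open>X\<close> be the pseudoinverse of \<open>A\<close>.
  Splitting \<open>u = w + \<Phi> c\<close> and using \<open>\<D> \<Phi> = \<Phi> X A\<close>, the reconstruction error becomes
  \<open>w + \<Phi> ((c - X A c - z) - X S\<^sup>T w)\<close>.
  Since \<open>X A\<close> is the orthogonal projection along the null space of \<open>A\<close>, the vector \<open>c - X A c\<close> is
  the orthogonal projection of \<open>c\<close> onto that null space, that is, \<open>Z Z\<^sup>T c\<close>
  (\<open>kernel_matrix_projection\<close>). The theorem is then Pythagoras applied twice: \<open>w\<close> is
  orthogonal to the range of \<open>\<Phi>\<close>, and inside the coefficient space, where \<open>\<Phi>\<close> is isometric,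
  the null space of \<open>A\<close>, which contains \<open>Z Z\<^sup>T c - z\<close>, is orthogonal to the range of \<open>X\<close>
  (\<open>moore_penrose_range_orthogonal_null_space\<close>).
\<close>

lemma norm_diff_Pythagorean:
  fixes a b :: "'a::real_inner"
  assumes "orthogonal a b"
  shows "(norm (a - b))\<^sup>2 = (norm a)\<^sup>2 + (norm b)\<^sup>2"
  using norm_add_Pythagorean[of a "- b"] assms by (simp add: orthogonal_def)

lemma inner_matrix_vector_transpose:
  fixes M :: "real^'c^'r"
  shows "(M *v x) \<bullet> y = x \<bullet> (transpose M *v y)"
  by (metis dot_lmul_matrix inner_commute transpose_matrix_vector)

lemma basis_matrix_cancel:
  assumes "basis_matrix \<Phi>"
  shows "transpose \<Phi> *v (\<Phi> *v x) = x"
  using assms by (simp add: basis_matrix_def matrix_vector_mul_assoc)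

lemma norm_basis_matrix:
  assumes "basis_matrix \<Phi>"
  shows "norm (\<Phi> *v x) = norm x"
  unfolding norm_eq_sqrt_inner inner_matrix_vector_transpose basis_matrix_cancel[OF assms] ..

lemma basis_matrix_residual_orthogonal:
  assumes "basis_matrix \<Phi>"
  shows "(u - \<Phi> *v (transpose \<Phi> *v u)) \<bullet> (\<Phi> *v x) = 0"
  by (metis assms basis_matrix_cancel inner_commute inner_matrix_vector_transpose inner_zero_right
      diff_self matrix_vector_mult_diff_distrib)

lemma columns_orthonormal_basis_matrix:
  assumes "\<And>i j. column i Z \<bullet> column j Z = (if i = j then 1 else 0)"
  shows "basis_matrix Z"
  using assms
  by (simp add: basis_matrix_def vec_eq_iff matrix_matrix_mult_def transpose_def mat_def
      column_def inner_vec_def)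

lemma kernel_matrix_basis_matrix: "kernel_matrix A Z \<Longrightarrow> basis_matrix Z"
  by (simp add: kernel_matrix_def columns_orthonormal_basis_matrix)

lemma kernel_matrix_range:
  assumes "kernel_matrix A Z"
  shows "null_space A = range ((*v) Z)"
proof -
  have "columns Z = (*v) Z ` Basis"
    by (auto simp: columns_image_basis Basis_vec_def)
  then show ?thesis
    using assms linear_span_image[OF matrix_vector_mul_linear, of Z Basis]
    by (simp add: kernel_matrix_def)
qed

lemma moore_penrose_residual_in_null_space:
  assumes "is_moore_penrose A X"
  shows "x - X *v (A *v x) \<in> null_space A"
  using assms
  by (simp add: is_moore_penrose_def null_space_def matrix_vector_mult_diff_distrib
      matrix_vector_mul_assoc matrix_mul_assoc)

text \<open>
  On the range of \<open>X\<close> the symmetric matrix \<open>X A\<close> acts as the identity, and it kills the null space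
  of \<open>A\<close>; moving \<open>X A\<close> across the inner product gives the orthogonality.
\<close>
lemma moore_penrose_range_orthogonal_null_space:
  assumes "is_moore_penrose A X" and "k \<in> null_space A"
  shows "k \<bullet> (X *v y) = 0"
proof -
  have "k \<bullet> (X *v y) = k \<bullet> ((X ** A) *v (X *v y))"
    using assms(1) by (simp add: is_moore_penrose_def matrix_vector_mul_assoc)
  also have "\<dots> = ((X ** A) *v k) \<bullet> (X *v y)"
    using assms(1) by (simp add: is_moore_penrose_def inner_matrix_vector_transpose)
  also have "\<dots> = 0"
    using assms(2) by (simp add: null_space_def flip: matrix_vector_mul_assoc)
  finally show ?thesis .
qed

text \<open>
  In \<open>c = (c - X A c) + X A c\<close> the first summand lies in the range of \<open>Z\<close>, which \<open>Z Z\<^sup>T\<close> fixes, and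
  the second is orthogonal to the columns of \<open>Z\<close>, hence killed by \<open>Z\<^sup>T\<close>.
\<close>
lemma kernel_matrix_projection:
  assumes "kernel_matrix A Z" and "is_moore_penrose A X"
  shows "Z *v (transpose Z *v c) = c - X *v (A *v c)"
proof -
  obtain b where b: "c - X *v (A *v c) = Z *v b"
    using moore_penrose_residual_in_null_space[OF assms(2), of c] kernel_matrix_range[OF assms(1)]
    by auto
  have "(transpose Z *v (X *v (A *v c))) \<bullet> y = 0" for y
    using moore_penrose_range_orthogonal_null_space[OF assms(2), of "Z *v y" "A *v c"]
      kernel_matrix_range[OF assms(1)]
    by (simp add: inner_matrix_vector_transpose inner_commute)
  then have "transpose Z *v (X *v (A *v c)) = 0"
    by (metis inner_eq_zero_iff)
  then have "transpose Z *v c = transpose Z *v (c - X *v (A *v c))"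
    by (simp add: matrix_vector_mult_diff_distrib)
  also have "\<dots> = b"
    using b basis_matrix_cancel[OF kernel_matrix_basis_matrix[OF assms(1)]] by simp
  finally show ?thesis
    using b by simp
qed

theorem theorem1:
  fixes \<Phi> :: "real^'m^'N"
    and S :: "real^'n^'N"
    and Z :: "real^'k^'m"
    and u :: "real^'N"
  assumes "1 \<le> CARD('n)" "CARD('n) < CARD('m)" "CARD('m) \<le> CARD('N)"
    and "CARD('k) = CARD('m) - CARD('n)"
    and "basis_matrix \<Phi>"
    and "selection_matrix S"
    and "rank (transpose S ** \<Phi>) = CARD('n)"
    and "kernel_matrix (transpose S ** \<Phi>) Z"
  shows "let D = deim_operator \<Phi> S;
             uhat = \<Phi> *v (transpose \<Phi> *v u);
             zhat = Z *v (transpose Z *v (transpose \<Phi> *v u))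
         in \<forall>z \<in> null_space (transpose S ** \<Phi>).
              (norm (u - sdeim_reconstruction \<Phi> S u z))\<^sup>2 =
                (norm (u - uhat))\<^sup>2 + (norm (D *v (u - uhat)))\<^sup>2 + (norm (zhat - z))\<^sup>2"
proof -
  define A where "A = transpose S ** \<Phi>"
  define X where "X = pinv A"
  define D where "D = deim_operator \<Phi> S"
  define c where "c = transpose \<Phi> *v u"
  define w where "w = u - \<Phi> *v c"
  define zhat where "zhat = Z *v (transpose Z *v c)"
  have \<Phi>: "basis_matrix \<Phi>" and Z: "kernel_matrix A Z"
    using assms by (simp_all add: A_def)
  have X: "is_moore_penrose A X"
    by (simp add: X_def is_moore_penrose_pinv)
  have D: "D *v v = \<Phi> *v (X *v (transpose S *v v))" for v
    by (simp add: D_def deim_operator_def X_def A_def flip: matrix_vector_mul_assoc)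
  have zhat: "zhat = c - X *v (A *v c)"
    unfolding zhat_def by (rule kernel_matrix_projection[OF Z X])
  have "(norm (u - sdeim_reconstruction \<Phi> S u z))\<^sup>2 =
      (norm w)\<^sup>2 + (norm (D *v w))\<^sup>2 + (norm (zhat - z))\<^sup>2"
    if z: "z \<in> null_space A" for z
  proof -
    define e where "e = X *v (transpose S *v w)"
    have "D *v u = D *v w + D *v (\<Phi> *v c)"
      by (simp add: w_def flip: matrix_vector_right_distrib)
    also have "\<dots> = \<Phi> *v (e + (c - zhat))"
      by (simp add: D e_def zhat A_def matrix_vector_right_distrib flip: matrix_vector_mul_assoc)
    finally have error: "u - sdeim_reconstruction \<Phi> S u z = w + \<Phi> *v ((zhat - z) - e)"
      by (simp add: sdeim_reconstruction_def w_def matrix_vector_right_distrib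
          matrix_vector_mult_diff_distrib flip: D_def)
    have "zhat - z \<in> null_space A"
      using moore_penrose_residual_in_null_space[OF X, of c] z
      by (simp add: zhat null_space_def matrix_vector_mult_diff_distrib)
    then have "orthogonal (zhat - z) e"
      unfolding e_def orthogonal_def by (rule moore_penrose_range_orthogonal_null_space[OF X])
    then have "(norm ((zhat - z) - e))\<^sup>2 = (norm (zhat - z))\<^sup>2 + (norm e)\<^sup>2"
      by (rule norm_diff_Pythagorean)
    moreover have "norm (D *v w) = norm e"
      by (simp add: D e_def norm_basis_matrix[OF \<Phi>])
    moreover have "orthogonal w (\<Phi> *v ((zhat - z) - e))"
      unfolding w_def c_def orthogonal_def by (rule basis_matrix_residual_orthogonal[OF \<Phi>])
    ultimately show ?thesis
      by (simp add: error norm_add_Pythagorean norm_basis_matrix[OF \<Phi>])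
  qed
  then show ?thesis
    by (simp add: Let_def A_def D_def w_def zhat_def c_def)
qed

end
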